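(* For any nonempty compact metric spaces $X$ and $Y$, the set $\mathcal{R}_{\mathrm{opt}}(X,Y)$ of optimal correspondences between $X$ and $Y$ is nonempty; that is, there exists a correspondence $R\in\mathcal{R}(X,Y)$ such that $d_{GH}(X,Y)=\frac12\operatorname{dis}R$.
   Context: For a metric space $Z$ and nonempty subsets $A,B\subset Z$, the Hausdorff distance is $d_H(A,B)=\max\bigl\{\sup_{a\in A}\inf_{b\in B}|ab|,\ \sup_{b\in B}\inf_{a\in A}|ba|\bigr\}$, where $|xy|$ denotes the distance between points $x,y$. The Gromov--Hausdorff distance $d_{GH}(X,Y)$ between metric spaces $X$ and $Y$ is the infimum of those $r$ for which there exist a metric space $Z$ and subsets $X',Y'\subset Z$ isometric to $X$ and $Y$ respectively (with the restricted metrics) such that $d_H(X',Y')\le r$. A correspondence between $X$ and $Y$ is a subset $R\subset X\times Y$ such that the restrictions to $R$ of the projections $(x,y)\mapsto x$ and $(x,y)\mapsto y$ are surjective onto $X$ and $Y$; $\mathcal{R}(X,Y)$ is the set of all correspondences between $X$ and $Y$. The distortion of a nonempty $\sigma\subset X\times Y$ is $\operatorname{dis}\sigma=\sup\bigl\{\bigl||xx'|-|yy'|\bigr|:(x,y)\in\sigma,\ (x',y')\in\sigma\bigr\}$. A correspondence $R\in\mathcal{R}(X,Y)$ is called optimal if $d_{GH}(X,Y)=\frac12\operatorname{dis}R$, and $\mathcal{R}_{\mathrm{opt}}(X,Y)$ denotes the set of all optimal correspondences. *)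

theory Defs
  imports "HOL-Analysis.Analysis"
begin

text \<open>
  Metric spaces are values of the library type \<open>'a metric\<close>: a carrier \<open>mspace X\<close> that is an
  arbitrary set over \<open>'a\<close>, with distance \<open>mdist X\<close>.  Suprema and infima of distances are taken in
  \<^typ>\<open>ereal\<close>, so that unbounded families give \<open>\<infinity>\<close>.
\<close>

definition hausdorff_dist :: "'a metric \<Rightarrow> 'a set \<Rightarrow> 'a set \<Rightarrow> ereal" where
  "hausdorff_dist Z A B =
     max (SUP a\<in>A. INF b\<in>B. ereal (mdist Z a b)) (SUP b\<in>B. INF a\<in>A. ereal (mdist Z b a))"

definition isometric :: "'a metric \<Rightarrow> 'b metric \<Rightarrow> bool" where
  "isometric X Y \<longleftrightarrow>
     (\<exists>f. bij_betw f (mspace X) (mspace Y) \<and>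
          (\<forall>x\<in>mspace X. \<forall>x'\<in>mspace X. mdist Y (f x) (f x') = mdist X x x'))"

definition gh_realizes :: "'a metric \<Rightarrow> 'b metric \<Rightarrow> 'c metric \<Rightarrow> real \<Rightarrow> bool" where
  "gh_realizes X Y Z r \<longleftrightarrow>
     (\<exists>X' Y'. X' \<subseteq> mspace Z \<and> Y' \<subseteq> mspace Z \<and>
        isometric X (submetric Z X') \<and> isometric Y (submetric Z Y') \<and>
        hausdorff_dist Z X' Y' \<le> ereal r)"

text \<open>
  A definition cannot quantify over all types, so the ambient space \<open>Z\<close> ranges over the metric spaces
  whose carrier is a set over \<open>'a + 'b\<close>.  This loses nothing: by \<open>gh_realizes_sum\<close> below, a value \<open>r\<close>
  realized by an ambient space over any type whatsoever is realized by one over \<open>'a + 'b\<close>.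
\<close>

definition gh_dist :: "'a metric \<Rightarrow> 'b metric \<Rightarrow> ereal" where
  "gh_dist X Y = Inf {ereal r | r. \<exists>Z :: ('a + 'b) metric. gh_realizes X Y Z r}"

definition correspondences :: "'a metric \<Rightarrow> 'b metric \<Rightarrow> ('a \<times> 'b) set set" where
  "correspondences X Y =
     {R. R \<subseteq> mspace X \<times> mspace Y \<and> fst ` R = mspace X \<and> snd ` R = mspace Y}"

definition distortion :: "'a metric \<Rightarrow> 'b metric \<Rightarrow> ('a \<times> 'b) set \<Rightarrow> ereal" where
  "distortion X Y \<sigma> =
     Sup {ereal \<bar>mdist X x x' - mdist Y y y'\<bar> | x y x' y'. (x, y) \<in> \<sigma> \<and> (x', y') \<in> \<sigma>}"

definition optimal_correspondences :: "'a metric \<Rightarrow> 'b metric \<Rightarrow> ('a \<times> 'b) set set" where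
  "optimal_correspondences X Y =
     {R \<in> correspondences X Y. gh_dist X Y = ereal (1/2) * distortion X Y R}"

lemma gh_realizes_sum:
  fixes X :: "'a metric" and Y :: "'b metric" and Z :: "'c metric"
  assumes "gh_realizes X Y Z r"
  shows "\<exists>Z' :: ('a + 'b) metric. gh_realizes X Y Z' r"
proof -
  obtain X' Y' where sub: "X' \<subseteq> mspace Z" "Y' \<subseteq> mspace Z"
    and iX: "isometric X (submetric Z X')" and iY: "isometric Y (submetric Z Y')"
    and dH: "hausdorff_dist Z X' Y' \<le> ereal r"
    using assms unfolding gh_realizes_def by blast
  have [simp]: "X' \<inter> mspace Z = X'" "Y' \<inter> mspace Z = Y'"
    using sub by auto
  obtain f where f: "bij_betw f (mspace X) X'"
    and fd: "\<And>x x'. x \<in> mspace X \<Longrightarrow> x' \<in> mspace X \<Longrightarrow> mdist Z (f x) (f x') = mdist X x x'"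
    using iX unfolding isometric_def by auto
  obtain g where g: "bij_betw g (mspace Y) Y'"
    and gd: "\<And>y y'. y \<in> mspace Y \<Longrightarrow> y' \<in> mspace Y \<Longrightarrow> mdist Z (g y) (g y') = mdist Y y y'"
    using iY unfolding isometric_def by auto
  define h where "h = (\<lambda>z. if z \<in> X' then Inl (inv_into (mspace X) f z)
                            else Inr (inv_into (mspace Y) g z) :: 'a + 'b)"
  define k where "k = case_sum f g"
  have kh [simp]: "k (h z) = z" if "z \<in> X' \<or> z \<in> Y'" for z
    using that f g by (auto simp: h_def k_def bij_betw_def f_inv_into_f)
  define M where "M = h ` (X' \<union> Y')"
  have "Metric_space M (\<lambda>u v. mdist Z (k u) (k v))"
  proof
    fix u v w
    show "0 \<le> mdist Z (k u) (k v)" by simp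
    show "mdist Z (k u) (k v) = mdist Z (k v) (k u)" by (rule mdist_commute)
    show "mdist Z (k u) (k v) = 0 \<longleftrightarrow> u = v" if "u \<in> M" "v \<in> M"
      using that sub by (auto simp: M_def) (metis kh mdist_zero subsetD)+
    show "mdist Z (k u) (k w) \<le> mdist Z (k u) (k v) + mdist Z (k v) (k w)"
      if "u \<in> M" "v \<in> M" "w \<in> M"
      using that sub by (auto simp: M_def intro!: mdist_triangle)
  qed
  then interpret Z': Metric_space M "\<lambda>u v. mdist Z (k u) (k v)" .
  define Z' where "Z' = metric (M, \<lambda>u v. mdist Z (k u) (k v))"
  have Z' [simp]: "mspace Z' = M" "mdist Z' u v = mdist Z (k u) (k v)" for u v
    by (simp_all add: Z'_def)
  have subM: "h ` X' \<subseteq> M" "h ` Y' \<subseteq> M" by (auto simp: M_def)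
  have inj: "inj_on h (X' \<union> Y')" by (rule inj_on_inverseI[where g = k]) auto
  have "bij_betw (h \<circ> f) (mspace X) (h ` X')" "bij_betw (h \<circ> g) (mspace Y) (h ` Y')"
    by (rule bij_betw_trans[OF f] bij_betw_trans[OF g],
        rule bij_betw_imageI, rule inj_on_subset[OF inj], auto)+
  moreover have "f x \<in> X'" if "x \<in> mspace X" for x using f that by (auto simp: bij_betw_def)
  moreover have "g y \<in> Y'" if "y \<in> mspace Y" for y using g that by (auto simp: bij_betw_def)
  ultimately have "isometric X (submetric Z' (h ` X'))" "isometric Y (submetric Z' (h ` Y'))"
    unfolding isometric_def using subM
    by (auto simp: Int_absorb2 fd gd intro!: exI[of _ "h \<circ> f"] exI[of _ "h \<circ> g"])
  moreover have "hausdorff_dist Z' (h ` X') (h ` Y') = hausdorff_dist Z X' Y'"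
  proof -
    have sup: "(SUP a\<in>h ` A. F a) = (SUP a\<in>A. F (h a))"
      and inf: "(INF a\<in>h ` A. F a) = (INF a\<in>A. F (h a))" for F :: "'a + 'b \<Rightarrow> ereal" and A
      by (simp_all only: image_image)
    show ?thesis
      unfolding hausdorff_dist_def sup inf by (intro arg_cong2[where f = max] SUP_cong INF_cong) auto
  qed
  ultimately show ?thesis
    unfolding gh_realizes_def using subM dH by (metis Z'(1))
qed

end

theory Submission
  imports Defs
begin

text \<open>
  Gluing \<open>X\<close> and \<open>Y\<close> along a correspondence \<open>R\<close> gives \<open>d\<^sub>G\<^sub>H \<le> dis R / 2\<close>; conversely, pairing the points
  at distance less than \<open>s\<close> in an ambient space with \<open>d\<^sub>H < s\<close> gives a correspondence of distortion at
  most \<open>2s\<close>.  So it remains to see that the infimum of the distortions is attained.  Every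
  correspondence contains the image of a selector: a family that assigns to each \<open>x\<close> a pair \<open>(x, _)\<close>
  and to each \<open>y\<close> a pair \<open>(_, y)\<close>.  Selectors form a compact space by Tychonoff's theorem, and those
  whose image has distortion at most \<open>c\<close> form a closed subset, so nested nonempty sublevel sets have
  a common point.
\<close>

section \<open>Elementary bounds for distortion and Hausdorff distance\<close>

lemma gh_dist_le: "gh_realizes X Y (Z :: ('a + 'b) metric) r \<Longrightarrow> gh_dist X Y \<le> ereal r"
  for X :: "'a metric" and Y :: "'b metric"
  unfolding gh_dist_def by (rule Inf_lower) blast

lemma distortion_le_iff:
  "distortion X Y R \<le> ereal c \<longleftrightarrow>
     (\<forall>p\<in>R. \<forall>q\<in>R. \<bar>mdist X (fst p) (fst q) - mdist Y (snd p) (snd q)\<bar> \<le> c)"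
  by (fastforce simp: distortion_def Sup_le_iff)

text \<open>Comparing a pair with itself contributes 0. For empty \<open>R\<close> the supremum in
  \<open>ereal\<close> would be \<open>-\<infinity>\<close>.\<close>

lemma distortion_nonneg:
  assumes "R \<noteq> {}"
  shows "0 \<le> distortion X Y R"
proof -
  obtain x y where "(x, y) \<in> R" using assms by auto
  then have "ereal \<bar>mdist X x x - mdist Y y y\<bar> \<le> distortion X Y R"
    unfolding distortion_def by (intro Sup_upper) blast
  then show ?thesis by (rule order_trans[rotated]) simp
qed

lemma hausdorff_dist_le:
  assumes "\<And>a. a \<in> A \<Longrightarrow> \<exists>b\<in>B. mdist Z a b \<le> r" "\<And>b. b \<in> B \<Longrightarrow> \<exists>a\<in>A. mdist Z b a \<le> r"
  shows "hausdorff_dist Z A B \<le> ereal r"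
proof -
  have "(INF b\<in>B. ereal (mdist Z a b)) \<le> ereal r" if "a \<in> A" for a
    using assms(1)[OF that] by (auto intro: INF_lower2)
  moreover have "(INF a\<in>A. ereal (mdist Z b a)) \<le> ereal r" if "b \<in> B" for b
    using assms(2)[OF that] by (auto intro: INF_lower2)
  ultimately show ?thesis
    by (auto simp: hausdorff_dist_def intro: SUP_least)
qed

text \<open>An infimum of distances need not be attained, so the strict bound is what yields actual
  points.\<close>

lemma hausdorff_dist_lessD:
  assumes "hausdorff_dist Z A B < ereal s"
  shows "a \<in> A \<Longrightarrow> \<exists>b\<in>B. mdist Z a b < s" "b \<in> B \<Longrightarrow> \<exists>a\<in>A. mdist Z a b < s"
proof -
  have 1: "(SUP a\<in>A. INF b\<in>B. ereal (mdist Z a b)) < s"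
    and 2: "(SUP b\<in>B. INF a\<in>A. ereal (mdist Z b a)) < s"
    using assms by (auto simp: hausdorff_dist_def)
  show "\<exists>b\<in>B. mdist Z a b < s" if "a \<in> A"
    using le_less_trans[OF SUP_upper[OF that] 1] by (simp add: INF_less_iff)
  show "\<exists>a\<in>A. mdist Z a b < s" if "b \<in> B"
    using le_less_trans[OF SUP_upper[OF that] 2] by (simp add: INF_less_iff mdist_commute)
qed

section \<open>Gluing along a correspondence: the upper bound for the distance\<close>

text \<open>The disjoint union keeps both metrics, and every pair of \<open>R\<close> becomes a
  bridge of length \<open>r\<close>. Two bridges cost \<open>2 * r\<close>, at least the distortion,
  so a detour through the other space is never a shortcut. Positivity of \<open>r\<close> separates
  the two copies, which makes this a metric.\<close>

lemma gh_realizes_glued: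
  fixes X :: "'a metric" and Y :: "'b metric"
  assumes R: "R \<in> correspondences X Y" and ne: "R \<noteq> {}" and "r > 0"
    and dis: "distortion X Y R \<le> ereal (2 * r)"
  shows "\<exists>Z :: ('a + 'b) metric. gh_realizes X Y Z r"
proof -
  define l where "l = (\<lambda>x y p. mdist X x (fst p) + r + mdist Y y (snd p))"
  define \<delta> where "\<delta> = (\<lambda>x y. INF p\<in>R. l x y p)"
  define D where "D = (\<lambda>u v. case u of
      Inl x \<Rightarrow> (case v of Inl x' \<Rightarrow> mdist X x x' | Inr y \<Rightarrow> \<delta> x y)
    | Inr y \<Rightarrow> (case v of Inl x \<Rightarrow> \<delta> x y | Inr y' \<Rightarrow> mdist Y y y'))"
  have mem: "fst p \<in> mspace X" "snd p \<in> mspace Y" if "p \<in> R" for p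
    using R that by (auto simp: correspondences_def)
  have bdd: "bdd_below (l x y ` R)" for x y
    using \<open>r > 0\<close> by (auto intro!: bdd_belowI2[where m = 0] simp: l_def)
  have \<delta>_lower: "\<delta> x y \<le> l x y p" if "p \<in> R" for x y p
    unfolding \<delta>_def using bdd that by (rule cINF_lower)
  have \<delta>_greatest: "m \<le> \<delta> x y" if "\<And>p. p \<in> R \<Longrightarrow> m \<le> l x y p" for m x y
    unfolding \<delta>_def using ne that by (rule cINF_greatest)
  \<comment> \<open>The two infima are removed one after the other, so a bound on their sum may be
    checked for fixed bridges.\<close>
  have \<delta>_greatest2: "m \<le> \<delta> x y + \<delta> x' y'"
    if *: "\<And>p q. p \<in> R \<Longrightarrow> q \<in> R \<Longrightarrow> m \<le> l x y p + l x' y' q" for m x y x' y'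
  proof -
    have "m - \<delta> x' y' \<le> l x y p" if "p \<in> R" for p
    proof -
      have "m - l x y p \<le> \<delta> x' y'"
        using *[OF that] by (intro \<delta>_greatest) (simp add: algebra_simps)
      then show ?thesis by simp
    qed
    then have "m - \<delta> x' y' \<le> \<delta> x y" by (rule \<delta>_greatest)
    then show ?thesis by simp
  qed
  have \<delta>_ge: "r \<le> \<delta> x y" for x y
    by (rule \<delta>_greatest) (simp add: l_def)
  have \<delta>_R: "\<delta> x y \<le> r" if "(x, y) \<in> R" for x y
  proof -
    have "mdist X x x = 0" "mdist Y y y = 0"
      using mem[OF that] by (simp_all add: mdist_zero)
    then show ?thesis using \<delta>_lower[OF that, of x y] by (simp add: l_def)
  qed
  have tri_X: "\<delta> x y \<le> mdist X x x' + \<delta> x' y" if "x \<in> mspace X" "x' \<in> mspace X" for x x' y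
  proof -
    have "\<delta> x y - mdist X x x' \<le> l x' y p" if "p \<in> R" for p
      using \<delta>_lower[OF that, of x y] mem[OF that] \<open>x \<in> mspace X\<close> \<open>x' \<in> mspace X\<close>
        mdist_triangle[of x X x' "fst p"]
      by (simp add: l_def)
    from \<delta>_greatest[OF this] show ?thesis by simp
  qed
  have tri_Y: "\<delta> x y \<le> mdist Y y y' + \<delta> x y'" if "y \<in> mspace Y" "y' \<in> mspace Y" for x y y'
  proof -
    have "\<delta> x y - mdist Y y y' \<le> l x y' p" if "p \<in> R" for p
      using \<delta>_lower[OF that, of x y] mem[OF that] \<open>y \<in> mspace Y\<close> \<open>y' \<in> mspace Y\<close>
        mdist_triangle[of y Y y' "snd p"]
      by (simp add: l_def)
    from \<delta>_greatest[OF this] show ?thesis by simp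
  qed
  have dis': "\<bar>mdist X (fst p) (fst q) - mdist Y (snd p) (snd q)\<bar> \<le> 2 * r"
    if "p \<in> R" "q \<in> R" for p q
    using dis that by (simp add: distortion_le_iff)
  \<comment> \<open>Go from \<open>x\<close> to \<open>x'\<close> through \<open>fst p\<close> and
    \<open>fst q\<close>. By \<open>dis'\<close> the middle leg exceeds the distance from
    \<open>snd p\<close> to \<open>snd q\<close> by at most \<open>2 * r\<close>, which the two
    bridges pay for; the rest is a detour through \<open>y\<close>.\<close>
  have tri_XY: "mdist X x x' \<le> \<delta> x y + \<delta> x' y"
    if "x \<in> mspace X" "x' \<in> mspace X" "y \<in> mspace Y" for x x' y
  proof (rule \<delta>_greatest2)
    fix p q assume "p \<in> R" "q \<in> R"
    with that mem dis'[of p q] show "mdist X x x' \<le> l x y p + l x' y q"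
      using mdist_triangle[of x X "fst p" x'] mdist_triangle[of "fst p" X "fst q" x']
        mdist_triangle[of "snd p" Y y "snd q"]
      by (simp add: l_def mdist_commute)
  qed
  have tri_YX: "mdist Y y y' \<le> \<delta> x y + \<delta> x y'"
    if "y \<in> mspace Y" "y' \<in> mspace Y" "x \<in> mspace X" for x y y'
  proof (rule \<delta>_greatest2)
    fix p q assume "p \<in> R" "q \<in> R"
    with that mem dis'[of p q] show "mdist Y y y' \<le> l x y p + l x y' q"
      using mdist_triangle[of y Y "snd p" y'] mdist_triangle[of "snd p" Y "snd q" y']
        mdist_triangle[of "fst p" X x "fst q"]
      by (simp add: l_def mdist_commute)
  qed
  have \<delta>_pos: "0 < \<delta> x y" for x y
    using \<delta>_ge[of x y] \<open>r > 0\<close> by simp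
  have "Metric_space (mspace X <+> mspace Y) D"
  proof
    fix u v w
    show "0 \<le> D u v" 
      using \<delta>_pos by (auto simp: D_def less_imp_le split: sum.split)
    show "D u v = D v u" 
      by (auto simp: D_def mdist_commute split: sum.split)
    show "D u v = 0 \<longleftrightarrow> u = v" if "u \<in> mspace X <+> mspace Y" "v \<in> mspace X <+> mspace Y"
      using that \<delta>_pos[THEN less_imp_neq, THEN not_sym] by (auto simp: D_def)
    show "D u w \<le> D u v + D v w"
      if "u \<in> mspace X <+> mspace Y" "v \<in> mspace X <+> mspace Y" "w \<in> mspace X <+> mspace Y"
    proof -
      \<comment> \<open>These reversed forms serve the cases where the first leg crosses between the
        spaces and the second does not.\<close>
      have "\<delta> x' y \<le> \<delta> x y + mdist X x x'" if "x \<in> mspace X" "x' \<in> mspace X" for x x' y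
        using tri_X[of x' x y] that by (simp add: mdist_commute)
      moreover have "\<delta> x y' \<le> \<delta> x y + mdist Y y y'" if "y \<in> mspace Y" "y' \<in> mspace Y" for x y y'
        using tri_Y[of y' y x] that by (simp add: mdist_commute)
      ultimately show ?thesis using that
        by (elim PlusE; simp add: D_def mdist_triangle tri_X tri_Y tri_XY tri_YX)
    qed
  qed
  then interpret Z: Metric_space "mspace X <+> mspace Y" D .
  define Z where "Z = metric (mspace X <+> mspace Y, D)"
  have Z [simp]: "mspace Z = mspace X <+> mspace Y" "mdist Z = D"
    by (simp_all add: Z_def)
  have "isometric X (submetric Z (Inl ` mspace X))" "isometric Y (submetric Z (Inr ` mspace Y))"
    unfolding isometric_def
    by (auto simp: D_def bij_betw_def Int_absorb2 intro!: exI[of _ Inl] exI[of _ Inr])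
  moreover have "hausdorff_dist Z (Inl ` mspace X) (Inr ` mspace Y) \<le> ereal r"
  proof (rule hausdorff_dist_le)
    fix a :: "'a + 'b" assume "a \<in> Inl ` mspace X"
    then obtain x where "a = Inl x" "x \<in> fst ` R"
      using R by (auto simp: correspondences_def)
    then show "\<exists>b\<in>Inr ` mspace Y. mdist Z a b \<le> r"
      using \<delta>_R mem by (force simp: D_def)
  next
    fix b :: "'a + 'b" assume "b \<in> Inr ` mspace Y"
    then obtain y where "b = Inr y" "y \<in> snd ` R"
      using R by (auto simp: correspondences_def)
    then show "\<exists>a\<in>Inl ` mspace X. mdist Z b a \<le> r"
      using \<delta>_R mem by (force simp: D_def)
  qed
  ultimately have "gh_realizes X Y Z r"
    unfolding gh_realizes_def
    by (intro exI[of _ "Inl ` mspace X"] exI[of _ "Inr ` mspace Y"]) auto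
  then show ?thesis ..
qed

text \<open>Gluing requires a positive bridge length, but half the distortion may be 0. Hence
  \<open>r\<close> is taken as \<open>c / 2 + e\<close>, and \<open>e\<close> tends to 0.\<close>

lemma gh_dist_le_half_distortion:
  fixes X :: "'a metric" and Y :: "'b metric"
  assumes R: "R \<in> correspondences X Y" and ne: "R \<noteq> {}"
  shows "gh_dist X Y \<le> ereal (1/2) * distortion X Y R"
proof (cases "distortion X Y R")
  case (real c)
  have "0 \<le> c"
    using distortion_nonneg[OF ne, of X Y] real by simp
  have "gh_dist X Y \<le> ereal (c / 2 + e)" if "e > 0" for e
  proof -
    have "\<exists>Z :: ('a + 'b) metric. gh_realizes X Y Z (c / 2 + e)"
      using R ne \<open>0 \<le> c\<close> that real by (intro gh_realizes_glued) auto
    then show ?thesis using gh_dist_le by blast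
  qed
  then have "gh_dist X Y \<le> ereal (c / 2)"
    by (auto intro: ereal_le_epsilon2[rule_format])
  then show ?thesis using real by simp
next
  case MInf
  then show ?thesis using distortion_nonneg[OF ne, of X Y] by simp
qed simp

section \<open>From an ambient space back to a correspondence\<close>

lemma gh_realizes_imp_correspondence:
  assumes "gh_realizes X Y Z r" and "r < s"
  shows "\<exists>R\<in>correspondences X Y. distortion X Y R \<le> ereal (2 * s)"
proof -
  obtain X' Y' where sub: "X' \<subseteq> mspace Z" "Y' \<subseteq> mspace Z"
    and iX: "isometric X (submetric Z X')" and iY: "isometric Y (submetric Z Y')"
    and dH: "hausdorff_dist Z X' Y' \<le> ereal r"
    using assms unfolding gh_realizes_def by blast
  have [simp]: "X' \<inter> mspace Z = X'" "Y' \<inter> mspace Z = Y'"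
    using sub by auto
  obtain f where f: "bij_betw f (mspace X) X'"
    and fd: "\<And>x x'. x \<in> mspace X \<Longrightarrow> x' \<in> mspace X \<Longrightarrow> mdist Z (f x) (f x') = mdist X x x'"
    using iX unfolding isometric_def by auto
  obtain g where g: "bij_betw g (mspace Y) Y'"
    and gd: "\<And>y y'. y \<in> mspace Y \<Longrightarrow> y' \<in> mspace Y \<Longrightarrow> mdist Z (g y) (g y') = mdist Y y y'"
    using iY unfolding isometric_def by auto
  have X': "X' = f ` mspace X" and Y': "Y' = g ` mspace Y"
    using f g by (auto simp: bij_betw_def)
  have less: "hausdorff_dist Z X' Y' < ereal s"
    using dH \<open>r < s\<close> by (simp add: le_less_trans)
  \<comment> \<open>The gap between \<open>r\<close> and \<open>s\<close> guarantees every point a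
    partner, even where the Hausdorff infima are not attained.\<close>
  define R where "R = {(x, y) \<in> mspace X \<times> mspace Y. mdist Z (f x) (g y) < s}"
  have "mspace X \<subseteq> fst ` R"
    using hausdorff_dist_lessD(1)[OF less] by (force simp: X' Y' R_def)
  moreover have "mspace Y \<subseteq> snd ` R"
    using hausdorff_dist_lessD(2)[OF less] by (force simp: X' Y' R_def)
  ultimately have "R \<in> correspondences X Y"
    by (auto simp: correspondences_def R_def)
  moreover have "distortion X Y R \<le> ereal (2 * s)"
    unfolding distortion_le_iff
  proof (intro ballI)
    fix p q assume "p \<in> R" "q \<in> R"
    then obtain x y x' y' where [simp]: "p = (x, y)" "q = (x', y')"
      and m: "x \<in> mspace X" "y \<in> mspace Y" "x' \<in> mspace X" "y' \<in> mspace Y"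
      and lt: "mdist Z (f x) (g y) < s" "mdist Z (f x') (g y') < s"
      by (auto simp: R_def)
    have z: "f x \<in> mspace Z" "f x' \<in> mspace Z" "g y \<in> mspace Z" "g y' \<in> mspace Z"
      using m sub by (auto simp: X' Y')
    \<comment> \<open>In the quadrilateral \<open>f x\<close>, \<open>g y\<close>,
      \<open>g y'\<close>, \<open>f x'\<close>, opposite sides differ by at most the sum of the two
      connecting sides, each below \<open>s\<close>.\<close>
    have "\<bar>mdist Z (f x) (f x') - mdist Z (g y) (g y')\<bar> \<le> 2 * s"
      using z lt mdist_triangle[of "f x" Z "g y" "f x'"] mdist_triangle[of "g y" Z "g y'" "f x'"]
        mdist_triangle[of "g y" Z "f x" "g y'"] mdist_triangle[of "f x" Z "f x'" "g y'"]
      by (simp add: mdist_commute)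
    then show "\<bar>mdist X (fst p) (fst q) - mdist Y (snd p) (snd q)\<bar> \<le> 2 * s"
      using m by (simp add: fd gd)
  qed
  ultimately show ?thesis by blast
qed

section \<open>Attaining the infimum of distortions by compactness of selectors\<close>

lemma correspondence_distortion_attained:
  fixes X :: "'a metric" and Y :: "'b metric"
  assumes cX: "compact_space (mtopology_of X)" and cY: "compact_space (mtopology_of Y)"
    and approx: "\<And>e. e > 0 \<Longrightarrow> \<exists>R\<in>correspondences X Y. distortion X Y R \<le> ereal (c + e)"
  shows "\<exists>R\<in>correspondences X Y. distortion X Y R \<le> ereal c"
proof -
  define I where "I = mspace X <+> mspace Y"
  define P where "P = prod_topology (mtopology_of X) (mtopology_of Y)"
  \<comment> \<open>\<open>S i\<close> is the fibre of pairs over the point \<open>i\<close>. It is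
    compact, and fixing one coordinate keeps the projections surjective for every selector.\<close>
  define S where "S = (\<lambda>i. case i of Inl x \<Rightarrow> {x} \<times> mspace Y | Inr y \<Rightarrow> mspace X \<times> {y})"
  define H where "H = product_topology (\<lambda>i. subtopology P (S i)) I"
  define osc where "osc = (\<lambda>(h :: 'a + 'b \<Rightarrow> 'a \<times> 'b) i j. \<bar>mdist X (fst (h i)) (fst (h j)) - mdist Y (snd (h i)) (snd (h j))\<bar>)"
  \<comment> \<open>The slack reflects that only distortions above \<open>c\<close> by an
    arbitrarily small amount are available at first; it vanishes in the intersection of all
    \<open>C n\<close>.\<close>
  define C where "C = (\<lambda>n. {h \<in> topspace H. \<forall>i\<in>I. \<forall>j\<in>I. osc h i j \<le> c + inverse (Suc n)})"
  have topH: "topspace H = (\<Pi>\<^sub>E i\<in>I. S i)"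
    unfolding H_def topspace_product_topology
    by (rule PiE_cong) (auto simp: P_def S_def I_def)
  have osc_le: "osc h i j \<le> b"
    if "distortion X Y R \<le> ereal b" "h i \<in> R" "h j \<in> R" for h i j b R
    using that by (simp add: osc_def distortion_le_iff)
  have "compactin P (S i)" if "i \<in> I" for i
    using that cX cY
    by (auto simp: I_def S_def P_def compactin_Times compact_space_def)
  then have "compact_space H"
    by (auto simp: H_def compact_space_product_topology compact_space_subtopology)
  moreover have "closedin H (C n)" for n
  proof -
    have proj: "continuous_map H P (\<lambda>h. h i)" if "i \<in> I" for i
      using continuous_map_product_projection[OF that, of "\<lambda>i. subtopology P (S i)"]
      by (simp add: H_def continuous_map_in_subtopology)
    have fst: "continuous_map H (mtopology_of X) (\<lambda>h. fst (h i))"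
      and snd: "continuous_map H (mtopology_of Y) (\<lambda>h. snd (h i))" if "i \<in> I" for i
      using proj[OF that] by (auto simp: P_def continuous_map_pairwise o_def)
    \<comment> \<open>Each condition involves only two coordinates, so it is closed in the product
      topology; \<open>C n\<close> is an intersection of such conditions.\<close>
    have "continuous_map H euclideanreal (\<lambda>h. osc h i j)" if "i \<in> I" "j \<in> I" for i j
      unfolding osc_def using that by (intro continuous_intros fst snd)
    then have "closedin H {h \<in> topspace H. osc h i j \<in> {..c + inverse (Suc n)}}"
      if "i \<in> I" "j \<in> I" for i j
      using that by (intro closedin_continuous_map_preimage) auto
    \<comment> \<open>Intersecting with \<open>topspace H\<close> covers empty \<open>I\<close>,
      where the inner intersection is the whole type.\<close>
    then have *: "closedin H (topspace H \<inter> \<Inter> ((\<lambda>(i, j). {h \<in> topspace H. osc h i j \<in> {..c + inverse (Suc n)}}) ` (I \<times> I)))"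
      by (cases "I = {}") (auto intro!: closedin_Int closedin_INT)
    show ?thesis by (rule back_subst[where P = "closedin H", OF *]) (auto simp: C_def)
  qed
  moreover have "C n \<noteq> {}" for n
  proof -
    obtain R where R: "R \<in> correspondences X Y" and d: "distortion X Y R \<le> ereal (c + inverse (Suc n))"
      using approx[of "inverse (Suc n)"] by auto
    \<comment> \<open>Surjectivity of both projections says exactly that \<open>R\<close> meets
      every fibre, so a selector can be chosen inside \<open>R\<close>; its distortion is no
      larger.\<close>
    have "\<exists>p. p \<in> R \<inter> S i" if i: "i \<in> I" for i
    proof -
      consider x where "i = Inl x" "x \<in> fst ` R" | y where "i = Inr y" "y \<in> snd ` R"
        using R i by (auto simp: I_def correspondences_def)
      then show ?thesis
        using R by cases (force simp: S_def correspondences_def)+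
    qed
    then obtain h where h: "\<And>i. i \<in> I \<Longrightarrow> h i \<in> R \<inter> S i" by metis
    \<comment> \<open>Points of \<open>H\<close> are extensional functions, hence the restriction to
      \<open>I\<close>.\<close>
    have "osc (restrict h I) i j \<le> c + inverse (Suc n)" if "i \<in> I" "j \<in> I" for i j
      using that h by (intro osc_le[OF d]) auto
    with h have "restrict h I \<in> C n"
      by (auto simp: C_def topH)
    then show ?thesis by blast
  qed
  moreover have "decseq C"
  proof (rule decseq_SucI)
    fix n
    have "inverse (real (Suc (Suc n))) \<le> inverse (real (Suc n))"
      by (intro le_imp_inverse_le) auto
    then have "osc h i j \<le> c + inverse (real (Suc n))"
      if "osc h i j \<le> c + inverse (real (Suc (Suc n)))" for h i j
      using that by linarith
    then show "C (Suc n) \<subseteq> C n"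
      unfolding C_def by blast
  qed
  ultimately have "(\<Inter>n. C n) \<noteq> {}" by (rule compact_space_imp_nest)
  then obtain h where h: "\<And>n. h \<in> C n" by blast
  have hS: "h i \<in> S i" if "i \<in> I" for i
    using h[of 0] that by (auto simp: C_def topH)
  have "osc h i j \<le> c" if "i \<in> I" "j \<in> I" for i j
  proof (rule field_le_epsilon)
    fix e :: real assume "e > 0"
    then obtain n where "inverse (Suc n) < e" using reals_Archimedean by blast
    moreover have "osc h i j \<le> c + inverse (Suc n)" using h[of n] that by (simp add: C_def)
    ultimately show "osc h i j \<le> c + e" by simp
  qed
  then have "distortion X Y (h ` I) \<le> ereal c"
    by (auto simp: distortion_le_iff osc_def)
  moreover have "h ` I \<in> correspondences X Y"
  proof -
    \<comment> \<open>The coordinate at a point lies over that point, so the image of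
      \<open>h\<close> projects onto both spaces.\<close>
    have L: "fst (h (Inl x)) = x" "snd (h (Inl x)) \<in> mspace Y" if "x \<in> mspace X" for x
      using hS[of "Inl x"] InlI[OF that, of "mspace Y"] by (auto simp: S_def I_def)
    have R: "snd (h (Inr y)) = y" "fst (h (Inr y)) \<in> mspace X" if "y \<in> mspace Y" for y
      using hS[of "Inr y"] InrI[OF that, of "mspace X"] by (auto simp: S_def I_def)
    have "S i \<subseteq> mspace X \<times> mspace Y" if "i \<in> I" for i
      using that by (auto simp: S_def I_def)
    then have "h ` I \<subseteq> mspace X \<times> mspace Y"
      using hS by blast
    moreover have "x \<in> fst ` h ` I" if "x \<in> mspace X" for x
      using L(1)[OF that] InlI[OF that] unfolding I_def by (metis imageI)
    moreover have "y \<in> snd ` h ` I" if "y \<in> mspace Y" for y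
      using R(1)[OF that] InrI[OF that] unfolding I_def by (metis imageI)
    ultimately show ?thesis by (auto simp: correspondences_def)
  qed
  ultimately show ?thesis by blast
qed

section \<open>Existence of an optimal correspondence from the two bounds\<close>

theorem theorem2p6:
  fixes X :: "'a metric" and Y :: "'b metric"
  assumes "mspace X \<noteq> {}" and "compact_space (mtopology_of X)"
    and "mspace Y \<noteq> {}" and "compact_space (mtopology_of Y)"
  shows "optimal_correspondences X Y \<noteq> {}"
proof -
  have ne: "R \<noteq> {}" if "R \<in> correspondences X Y" for R
    using that assms(1) by (auto simp: correspondences_def)
  have lower: "gh_dist X Y \<le> ereal (1/2) * distortion X Y R" if "R \<in> correspondences X Y" for R
    using that ne[OF that] by (rule gh_dist_le_half_distortion)
  have approx: "\<exists>R\<in>correspondences X Y. distortion X Y R \<le> ereal (2 * s)"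
    if less: "gh_dist X Y < ereal s" for s
  proof -
    obtain r and Z :: "('a + 'b) metric" where "gh_realizes X Y Z r" "r < s"
      using less by (auto simp: gh_dist_def Inf_less_iff)
    then show ?thesis by (rule gh_realizes_imp_correspondence)
  qed
  show ?thesis
  proof (cases "gh_dist X Y")
    case (real d)
    have "\<exists>R\<in>correspondences X Y. distortion X Y R \<le> ereal (2 * d + e)" if "e > 0" for e
      \<comment> \<open>Doubling \<open>d + e / 2\<close> gives \<open>2 * d + e\<close>.\<close>
      using approx[of "d + e / 2"] that real by (simp add: algebra_simps)
    then obtain R where R: "R \<in> correspondences X Y" "distortion X Y R \<le> ereal (2 * d)"
      using correspondence_distortion_attained[OF assms(2,4)] by blast
    have "ereal (1/2) * distortion X Y R \<le> ereal (1/2) * ereal (2 * d)"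
      using R(2) by (rule ereal_mult_left_mono) simp
    then have "gh_dist X Y = ereal (1/2) * distortion X Y R"
      using lower[OF R(1)] real by simp
    then show ?thesis using R(1) by (auto simp: optimal_correspondences_def)
  next
    \<comment> \<open>If the distance is infinite, \<open>lower\<close> makes any correspondence
      optimal, and the full product is one.\<close>
    case PInf
    have R: "mspace X \<times> mspace Y \<in> correspondences X Y"
      using assms(1,3) by (auto simp: correspondences_def)
    from lower[OF R] PInf
    have "gh_dist X Y = ereal (1/2) * distortion X Y (mspace X \<times> mspace Y)" by simp
    with R show ?thesis by (auto simp: optimal_correspondences_def)
  next
    \<comment> \<open>Any negative bound, here -1, would produce a correspondence of negative
      distortion.\<close>
    case MInf
    then obtain R where "R \<in> correspondences X Y" "distortion X Y R \<le> ereal (2 * - 1)"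
      using approx[of "- 1"] by auto
    then have "0 \<le> ereal (2 * - 1)"
      by (rule order_trans[OF distortion_nonneg[OF ne]])
    then show ?thesis by simp
  qed
qed

end
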